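(* For any connected graph $G$ the following hold: (i) $\sigma^{\boxtimes}_V(G) - \sigma^{\boxtimes}_E(G) \leq 1$; (ii) $\sigma^{\Box}_V(G) - \sigma^{\Box}_E(G) \leq 1$; and (iii) $\sigma^{\times}_V(G) - \sigma^{\times}_E(G) \leq 1$.
   Context: All graphs are finite, simple and non-empty; $d_H$ denotes the shortest-path distance in $H$. A function $f: V(P)\to V(H)$ is a weak homomorphism $f:P\to H$ if for every edge $uv\in E(P)$ either $f(u)f(v)\in E(H)$ or $f(u)=f(v)$. It is surjective if $f(V(P))=V(H)$. It is edge surjective if it is surjective and for every $uv\in E(H)$ there is an edge $xy\in E(P)$ with $u=f(x)$ and $v=f(y)$. For weak homomorphisms $f,g:P\to H$ put $m_P(f,g)=\min\{d_H(f(u),g(u)) \mid u\in V(P)\}$. Two weak homomorphisms $f,g:P\to H$ are aligned if for every $uv\in E(P)$: $f(u)f(v)\in E(H) \Leftrightarrow g(u)g(v)\in E(H)$. They are opposite if for every $uv\in E(P)$: $f(u)f(v)\in E(H)\Leftrightarrow g(u)=g(v)$. For a connected graph $H$, each span below is the maximum of $m_P(f,g)$ over all (finite) paths $P$ and all pairs $f,g:P\to H$ of weak homomorphisms of the indicated kind: - strong vertex span $\sigma^{\boxtimes}_V(H)$: $f,g$ surjective; - strong edge span $\sigma^{\boxtimes}_E(H)$: $f,g$ edge surjective; - direct vertex span $\sigma^{\times}_V(H)$: $f,g$ surjective and aligned; - direct edge span $\sigma^{\times}_E(H)$: $f,g$ edge surjective and aligned; - Cartesian vertex span $\sigma^{\Box}_V(H)$: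 $f,g$ surjective and opposite; - Cartesian edge span $\sigma^{\Box}_E(H)$: $f,g$ edge surjective and opposite. *)

theory Defs
  imports "Graph_Theory.Pair_Digraph" "Graph_Theory.Digraph_Component"
begin

text \<open>
  Finite simple graphs are the \<^locale>\<open>pair_graph\<close>s of the library: finite, loop-free
  and with a symmetric arc relation, so an undirected edge \<open>uv\<close> is the pair of arcs
  \<open>(u,v)\<close>, \<open>(v,u)\<close>.
\<close>

text \<open>Meaningful only if \<open>u\<close> and \<open>v\<close> lie in the same component of \<open>H\<close>.\<close>

definition graph_dist :: "'a pair_pre_digraph \<Rightarrow> 'a \<Rightarrow> 'a \<Rightarrow> nat" where
  "graph_dist H u v = (LEAST n. \<exists>p. pre_digraph.apath (with_proj H) u p v \<and> length p = n)"

text \<open>The one-vertex graph counts as a path.\<close>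

definition path_graph :: "'b pair_pre_digraph \<Rightarrow> bool" where
  "path_graph P \<longleftrightarrow> (\<exists>vs. vs \<noteq> [] \<and> distinct vs \<and> pverts P = set vs \<and>
     parcs P = {(vs ! i, vs ! Suc i) | i. Suc i < length vs}
             \<union> {(vs ! Suc i, vs ! i) | i. Suc i < length vs})"

definition weak_hom :: "'b pair_pre_digraph \<Rightarrow> 'a pair_pre_digraph \<Rightarrow> ('b \<Rightarrow> 'a) \<Rightarrow> bool" where
  "weak_hom P H f \<longleftrightarrow> (\<forall>u \<in> pverts P. f u \<in> pverts H) \<and>
     (\<forall>(u, v) \<in> parcs P. (f u, f v) \<in> parcs H \<or> f u = f v)"

definition surjective :: "'b pair_pre_digraph \<Rightarrow> 'a pair_pre_digraph \<Rightarrow> ('b \<Rightarrow> 'a) \<Rightarrow> bool" where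
  "surjective P H f \<longleftrightarrow> f ` pverts P = pverts H"

definition edge_surjective :: "'b pair_pre_digraph \<Rightarrow> 'a pair_pre_digraph \<Rightarrow> ('b \<Rightarrow> 'a) \<Rightarrow> bool" where
  "edge_surjective P H f \<longleftrightarrow> surjective P H f \<and>
     (\<forall>(u, v) \<in> parcs H. \<exists>(x, y) \<in> parcs P. u = f x \<and> v = f y)"

definition min_dist ::
    "'b pair_pre_digraph \<Rightarrow> 'a pair_pre_digraph \<Rightarrow> ('b \<Rightarrow> 'a) \<Rightarrow> ('b \<Rightarrow> 'a) \<Rightarrow> nat" where
  "min_dist P H f g = Min ((\<lambda>u. graph_dist H (f u) (g u)) ` pverts P)"

definition aligned ::
    "'b pair_pre_digraph \<Rightarrow> 'a pair_pre_digraph \<Rightarrow> ('b \<Rightarrow> 'a) \<Rightarrow> ('b \<Rightarrow> 'a) \<Rightarrow> bool" where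
  "aligned P H f g \<longleftrightarrow> (\<forall>(u, v) \<in> parcs P. (f u, f v) \<in> parcs H \<longleftrightarrow> (g u, g v) \<in> parcs H)"

definition opposite ::
    "'b pair_pre_digraph \<Rightarrow> 'a pair_pre_digraph \<Rightarrow> ('b \<Rightarrow> 'a) \<Rightarrow> ('b \<Rightarrow> 'a) \<Rightarrow> bool" where
  "opposite P H f g \<longleftrightarrow> (\<forall>(u, v) \<in> parcs P. (f u, f v) \<in> parcs H \<longleftrightarrow> g u = g v)"

text \<open>
  Taking \<^typ>\<open>nat\<close> as the vertex type of the paths loses nothing, since every finite path is
  isomorphic to one of these. For finite connected \<open>H\<close> the set of values of \<open>min_dist\<close> is
  contained in the finite set of distances of \<open>H\<close>, and for each of the spans below it is
  nonempty, so \<^const>\<open>Max\<close> is the true maximum.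
\<close>

definition span_of ::
    "'a pair_pre_digraph \<Rightarrow> (nat pair_pre_digraph \<Rightarrow> (nat \<Rightarrow> 'a) \<Rightarrow> (nat \<Rightarrow> 'a) \<Rightarrow> bool) \<Rightarrow> nat" where
  "span_of H K = Max {min_dist P H f g | P f g.
     path_graph P \<and> weak_hom P H f \<and> weak_hom P H g \<and> K P f g}"

definition strong_vertex_span :: "'a pair_pre_digraph \<Rightarrow> nat" where
  "strong_vertex_span H = span_of H (\<lambda>P f g. surjective P H f \<and> surjective P H g)"

definition strong_edge_span :: "'a pair_pre_digraph \<Rightarrow> nat" where
  "strong_edge_span H = span_of H (\<lambda>P f g. edge_surjective P H f \<and> edge_surjective P H g)"

definition direct_vertex_span :: "'a pair_pre_digraph \<Rightarrow> nat" where
  "direct_vertex_span H =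
     span_of H (\<lambda>P f g. surjective P H f \<and> surjective P H g \<and> aligned P H f g)"

definition direct_edge_span :: "'a pair_pre_digraph \<Rightarrow> nat" where
  "direct_edge_span H =
     span_of H (\<lambda>P f g. edge_surjective P H f \<and> edge_surjective P H g \<and> aligned P H f g)"

definition cartesian_vertex_span :: "'a pair_pre_digraph \<Rightarrow> nat" where
  "cartesian_vertex_span H =
     span_of H (\<lambda>P f g. surjective P H f \<and> surjective P H g \<and> opposite P H f g)"

definition cartesian_edge_span :: "'a pair_pre_digraph \<Rightarrow> nat" where
  "cartesian_edge_span H =
     span_of H (\<lambda>P f g. edge_surjective P H f \<and> edge_surjective P H g \<and> opposite P H f g)"

end

theory Submission
  imports Defs
begin

text \<open>
  A pair \<open>f, g\<close> of weak homomorphisms from a path is a walk of a pair of players on \<open>G\<close>.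
  Let \<open>f, g\<close> be vertex surjective at distance at least \<open>k\<close>. Steps can be undone, so it suffices
  that, within the states at distance at least \<open>k - 1\<close>, some component contains for every arc
  \<open>(u, v)\<close> and each player a step that moves this player from \<open>u\<close> to \<open>v\<close>.

  For the strong and Cartesian rules the component of \<open>f, g\<close> works: when a player is at \<open>u\<close>, it
  steps to \<open>v\<close> while the other one waits. For the direct rule the other player has to move too
  and the distance may drop by two. Instead, remove the idle steps and delay \<open>g\<close> by one step, which
  keeps the distance at least \<open>k - 1\<close>. From \<open>(f t, g (t - 1))\<close> with \<open>f t = u\<close>, move the first
  player to \<open>v\<close> and the second to \<open>g t\<close>: since \<open>v\<close> is adjacent to \<open>f t\<close>, the distance is at
  least \<open>k - 1\<close> again.
\<close>

section \<open>Walks covering a component of a symmetric relation\<close>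

definition walk :: "('s \<Rightarrow> 's \<Rightarrow> bool) \<Rightarrow> 's \<Rightarrow> 's list \<Rightarrow> 's \<Rightarrow> bool" where
  "walk R a xs b \<longleftrightarrow> xs \<noteq> [] \<and> hd xs = a \<and> last xs = b \<and> successively R xs"

lemma walk_append:
  assumes "walk R a xs b" "walk R b ys c"
  shows "walk R a (xs @ tl ys) c"
  using assms by (cases ys) (auto simp: walk_def successively_append_iff successively_Cons)

lemma walk_step: "R a b \<Longrightarrow> walk R a [a, b] b"
  by (simp add: walk_def)

lemma rtranclp_walk: "R\<^sup>*\<^sup>* a b \<Longrightarrow> \<exists>xs. walk R a xs b"
proof (induction rule: rtranclp_induct)
  case base
  have "walk R a [a] a" by (simp add: walk_def)
  then show ?case ..
next
  case (step b c)
  then show ?case using walk_append walk_step by metis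
qed

lemma successively_rtranclp_nth:
  "successively R xs \<Longrightarrow> i < length xs \<Longrightarrow> R\<^sup>*\<^sup>* (xs ! 0) (xs ! i)"
proof (induction i)
  case (Suc i)
  then show ?case by (meson Suc_lessD rtranclp.rtrancl_into_rtrancl successively_conv_nth)
qed simp

lemma walk_rtranclp: "walk R a xs b \<Longrightarrow> R\<^sup>*\<^sup>* a b"
  using successively_rtranclp_nth[of R xs "length xs - 1"]
  by (auto simp: walk_def hd_conv_nth last_conv_nth)

text \<open>Symmetry of \<open>R\<close> lets a walk return from its current end to
  \<open>z\<close>, so the steps in \<open>F\<close> can be appended one after another, each reached
  by a detour through \<open>z\<close>.\<close>

lemma walk_through_steps:
  assumes "finite F" and "symp R"
    and "\<And>p q. (p, q) \<in> F \<Longrightarrow> R\<^sup>*\<^sup>* z p \<and> R p q"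
  shows "\<exists>xs e. walk R z xs e \<and> (\<forall>(p, q) \<in> F. \<exists>ys zs. xs = ys @ [p, q] @ zs)"
  using assms(1,3)
proof (induction F rule: finite_induct)
  case empty
  have "walk R z [z] z" by (simp add: walk_def)
  then show ?case by blast
next
  case (insert pq F)
  obtain p q where pq: "pq = (p, q)" by (cases pq)
  have "\<exists>xs e. walk R z xs e \<and> (\<forall>(p, q) \<in> F. \<exists>ys zs. xs = ys @ [p, q] @ zs)"
    by (rule insert.IH) (use insert.prems in blast)
  then obtain xs e where xs: "walk R z xs e" "\<forall>(p, q) \<in> F. \<exists>ys zs. xs = ys @ [p, q] @ zs"
    by blast
  have "R\<^sup>*\<^sup>* e z"
    using walk_rtranclp[OF xs(1)] symp_rtranclp[OF \<open>symp R\<close>] by (simp add: sympD)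
  moreover have zp: "R\<^sup>*\<^sup>* z p" "R p q" using insert.prems pq by auto
  ultimately obtain ws where "walk R e ws p"
    using rtranclp_walk by (metis rtranclp_trans)
  then have ws: "walk R z (xs @ tl ws) p" using walk_append[OF xs(1)] by simp
  let ?xs = "(xs @ tl ws) @ tl [p, q]"
  have "walk R z ?xs q" using walk_append[OF ws walk_step] zp(2) .
  \<comment> \<open>The walk built so far ends in \<open>p\<close>, so splitting off its last entry
    shows \<open>p, q\<close> as consecutive entries.\<close>
  moreover have "?xs = butlast (xs @ tl ws) @ [p, q] @ []"
    using ws append_butlast_last_id[of "xs @ tl ws"] unfolding walk_def
    by (simp del: butlast_append append_butlast_last_id)
  moreover have "\<exists>ys zs. ?xs = ys @ [a, b] @ zs" if "(a, b) \<in> F" for a b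
    using xs(2) that by fastforce
  ultimately show ?case unfolding pq by blast
qed

section \<open>Distances\<close>

locale connected_pair_graph = pair_graph G for G :: "'a pair_pre_digraph" +
  assumes connected: "connected (with_proj G)"
begin

lemma arc_sym: "(u, v) \<in> parcs G \<longleftrightarrow> (v, u) \<in> parcs G"
  using pair_sym_arcs by (auto simp: symmetric_def dest: symD)

lemma no_loop [simp]: "(u, u) \<notin> parcs G"
  using pair_no_loops by fastforce

lemma reachable:
  assumes "u \<in> pverts G" "v \<in> pverts G"
  shows "u \<rightarrow>\<^sup>*\<^bsub>with_proj G\<^esub> v"
proof -
  have "u \<rightarrow>\<^sup>*\<^bsub>with_proj (mk_symmetric G)\<^esub> v"
    using connected assms by (simp add: connected_def strongly_connected_def)
  then show ?thesis
    using pair_sym_arcs by (simp add: reachable_mk_symmetric_eq)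
qed

lemma rtrancl_parcs:
  assumes "u \<in> pverts G" "v \<in> pverts G"
  shows "(u, v) \<in> (parcs G)\<^sup>*"
  using reachable_rtranclI[OF reachable[OF assms]] by simp

text \<open>Distance is minimal over simple paths only; cutting closed subwalks out of a walk leaves
  such a path and never lengthens it.\<close>

lemma graph_dist_le_awalk:
  assumes "awalk u p v"
  shows "graph_dist G u v \<le> length p"
  using assms
proof (induction rule: awalk_to_apath_induct)
  case (path p)
  then have "apath u p v" by (simp add: apath_def)
  then show ?case unfolding graph_dist_def by (intro Least_le) auto
next
  case (decomp p q r s)
  then have "length (q @ s) \<le> length p"
    by (auto elim!: awalk_cyc_decompE)
  then show ?case using decomp by linarith
qed

lemma shortest_awalk:
  assumes "u \<in> pverts G" "v \<in> pverts G"
  obtains p where "awalk u p v" "length p = graph_dist G u v"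
proof -
  obtain p where "apath u p v"
    using reachable[OF assms] reachable_apath by auto
  then have "\<exists>n p. apath u p v \<and> length p = n" by blast
  from LeastI_ex[OF this] show ?thesis
    using that unfolding graph_dist_def by (auto simp: apath_def)
qed

text \<open>Prepending the arc to a shortest walk from \<open>v\<close>. Hence one player moving
  along an arc costs at most one unit of distance.\<close>

lemma graph_dist_arc_fst:
  assumes "(u, v) \<in> parcs G" "w \<in> pverts G"
  shows "graph_dist G u w \<le> Suc (graph_dist G v w)"
proof -
  obtain p where "awalk v p w" "length p = graph_dist G v w"
    using shortest_awalk assms in_arcsD2 by metis
  then show ?thesis
    using graph_dist_le_awalk[of u "(u, v) # p" w] assms by (simp add: awalk_Cons_iff)
qed

lemma graph_dist_arc_snd:
  assumes "(u, v) \<in> parcs G" "w \<in> pverts G"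
  shows "graph_dist G w v \<le> Suc (graph_dist G w u)"
proof -
  obtain p where "awalk w p u" "length p = graph_dist G w u"
    using shortest_awalk assms in_arcsD1 by metis
  moreover have "awalk u [(u, v)] v" using arc_implies_awalk[OF assms(1)] by simp
  ultimately show ?thesis
    using graph_dist_le_awalk[of w "p @ [(u, v)]" v] awalk_appendI by fastforce
qed


end

section \<open>Pairs of walks as walks on pairs\<close>

definition path_on :: "nat \<Rightarrow> nat pair_pre_digraph" where
  "path_on n = \<lparr>pverts = {..<n},
     parcs = {(i, Suc i) | i. Suc i < n} \<union> {(Suc i, i) | i. Suc i < n}\<rparr>"

lemma path_graph_path_on:
  assumes "0 < n"
  shows "path_graph (path_on n)"
proof -
  have "{([0..<n] ! i, [0..<n] ! Suc i) | i. Suc i < length [0..<n]} = {(i, Suc i) | i. Suc i < n}"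
       "{([0..<n] ! Suc i, [0..<n] ! i) | i. Suc i < length [0..<n]} = {(Suc i, i) | i. Suc i < n}"
    by (intro Collect_cong ex_cong1; auto)+
  then show ?thesis
    unfolding path_graph_def path_on_def
    by (intro exI[of _ "[0..<n]"]) (use assms in \<open>simp add: atLeast0LessThan\<close>)
qed

lemma path_graph_finite: "path_graph P \<Longrightarrow> finite (pverts P) \<and> pverts P \<noteq> {}"
  by (auto simp: path_graph_def)

text \<open>A common form of all six spans: being aligned or opposite is a condition on single arcs
  of the path, so it becomes a relation \<open>T\<close> between consecutive pairs of
  positions.\<close>

definition span_via ::
    "(nat pair_pre_digraph \<Rightarrow> 'a pair_pre_digraph \<Rightarrow> (nat \<Rightarrow> 'a) \<Rightarrow> bool) \<Rightarrow>
     ('a \<times> 'a \<Rightarrow> 'a \<times> 'a \<Rightarrow> bool) \<Rightarrow> 'a pair_pre_digraph \<Rightarrow> nat set" where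
  "span_via S T H = {min_dist P H f g | P f g.
     path_graph P \<and> weak_hom P H f \<and> weak_hom P H g \<and> S P H f \<and> S P H g \<and>
     (\<forall>(x, y) \<in> parcs P. T (f x, g x) (f y, g y))}"

section \<open>States of two players and coverage of all arcs\<close>

context connected_pair_graph
begin

text \<open>Adjacency, loops included, in the strong product of \<open>G\<close> with itself,
  restricted by the rule \<open>T\<close> and to pairs at distance at least
  \<open>k\<close>.\<close>

definition state_step :: "('a \<times> 'a \<Rightarrow> 'a \<times> 'a \<Rightarrow> bool) \<Rightarrow> nat \<Rightarrow> 'a \<times> 'a \<Rightarrow> 'a \<times> 'a \<Rightarrow> bool" where
  "state_step T k p q \<longleftrightarrow> p \<in> pverts G \<times> pverts G \<and> q \<in> pverts G \<times> pverts G \<and>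
     (fst p = fst q \<or> (fst p, fst q) \<in> parcs G) \<and> (snd p = snd q \<or> (snd p, snd q) \<in> parcs G) \<and>
     T p q \<and> k \<le> graph_dist G (fst p) (snd p) \<and> k \<le> graph_dist G (fst q) (snd q)"

lemma state_step_mono:
  "state_step T k p q \<Longrightarrow> l \<le> k \<Longrightarrow> state_step T l p q"
  by (auto simp: state_step_def)

lemma symp_state_step: "symp T \<Longrightarrow> symp (state_step T k)"
  unfolding symp_def state_step_def using arc_sym by metis

text \<open>The start \<open>z\<close> selects one component of the states. Within it the two
  players may cover a given arc at different moments.\<close>

definition covers :: "('a \<times> 'a \<Rightarrow> 'a \<times> 'a \<Rightarrow> bool) \<Rightarrow> nat \<Rightarrow> bool" where
  "covers T k \<longleftrightarrow> (\<exists>z.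
     (\<forall>u v. (u, v) \<in> parcs G \<longrightarrow>
       (\<exists>p q. (state_step T k)\<^sup>*\<^sup>* z p \<and> state_step T k p q \<and> fst p = u \<and> fst q = v)) \<and>
     (\<forall>u v. (u, v) \<in> parcs G \<longrightarrow>
       (\<exists>p q. (state_step T k)\<^sup>*\<^sup>* z p \<and> state_step T k p q \<and> snd p = u \<and> snd q = v)))"

lemma vertex_in_arc:
  assumes "parcs G \<noteq> {}" "u \<in> pverts G"
  obtains v where "(u, v) \<in> parcs G"
proof -
  obtain a b where ab: "(a, b) \<in> parcs G" using assms(1) by auto
  show thesis
  proof (cases "u = a")
    case False
    have "(u, a) \<in> (parcs G)\<^sup>*" using rtrancl_parcs assms(2) ab in_arcsD1 by blast
    then show thesis using False that by (metis converse_rtranclE)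
  qed (use ab that in blast)
qed

text \<open>One walk through all steps reachable from \<open>z\<close> traverses every arc with each
  player; its two coordinates are the required maps on a path.\<close>

lemma covers_realise:
  assumes "covers T k" "symp T" "parcs G \<noteq> {}"
  shows "\<exists>d \<in> span_via edge_surjective T G. k \<le> d"
proof -
  let ?R = "state_step T k"
  obtain z where
    z1: "\<And>u v. (u, v) \<in> parcs G \<Longrightarrow> \<exists>p q. ?R\<^sup>*\<^sup>* z p \<and> ?R p q \<and> fst p = u \<and> fst q = v" and
    z2: "\<And>u v. (u, v) \<in> parcs G \<Longrightarrow> \<exists>p q. ?R\<^sup>*\<^sup>* z p \<and> ?R p q \<and> snd p = u \<and> snd q = v"
    using assms(1) unfolding covers_def by blast
  let ?F = "{(p, q). ?R\<^sup>*\<^sup>* z p \<and> ?R p q}"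
  have "?F \<subseteq> (pverts G \<times> pverts G) \<times> (pverts G \<times> pverts G)"
    by (auto simp: state_step_def)
  then have "finite ?F"
    using pair_finite_verts finite_subset by blast
  then obtain xs e where xs: "walk ?R z xs e"
    and F: "\<forall>(p, q) \<in> ?F. \<exists>ys zs. xs = ys @ [p, q] @ zs"
    using walk_through_steps[of ?F ?R z] symp_state_step[OF assms(2)] by blast
  define n where "n = length xs"
  define f where "f i = fst (xs ! i)" for i
  define g where "g i = snd (xs ! i)" for i
  have "n > 0" using xs by (simp add: n_def walk_def)
  have fg: "(f i, g i) = xs ! i" for i by (simp add: f_def g_def)
  have R: "?R (f x, g x) (f y, g y)" if "(x, y) \<in> parcs (path_on n)" for x y
  proof -
    have "?R (xs ! i) (xs ! Suc i)" if "Suc i < n" for i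
      using xs that by (simp add: walk_def successively_conv_nth n_def)
    moreover from this have "?R (xs ! Suc i) (xs ! i)" if "Suc i < n" for i
      using symp_state_step[OF assms(2)] that by (metis sympD)
    ultimately show ?thesis
      using that unfolding fg by (auto simp: path_on_def)
  qed
  have arc: "\<exists>x y. (x, y) \<in> parcs (path_on n) \<and> (f x, g x) = p \<and> (f y, g y) = q"
    if pq: "?R\<^sup>*\<^sup>* z p" "?R p q" for p q
  proof -
    obtain ys zs where "xs = ys @ [p, q] @ zs" using bspec[OF F, of "(p, q)"] pq by auto
    then have "Suc (length ys) < n" "xs ! length ys = p" "xs ! Suc (length ys) = q"
      by (auto simp: n_def nth_append)
    then show ?thesis unfolding fg by (auto simp: path_on_def)
  qed
  have edges: "\<exists>(x, y) \<in> parcs (path_on n). u = f x \<and> v = f y"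
              "\<exists>(x, y) \<in> parcs (path_on n). u = g x \<and> v = g y"
    if uv: "(u, v) \<in> parcs G" for u v
    using z1[OF uv] z2[OF uv] arc by fastforce+
  \<comment> \<open>The conditions on a state are read off from the steps at it, so each position
    must lie on an arc of the path; a single arc of \<open>G\<close> already forces two
    positions.\<close>
  have vert: "\<exists>y. (x, y) \<in> parcs (path_on n)" if "x \<in> pverts (path_on n)" for x
  proof -
    obtain u v where "(u, v) \<in> parcs G" using assms(3) by auto
    then obtain a b where "(a, b) \<in> parcs (path_on n)" using edges(1) by blast
    then have "Suc 0 < n" by (auto simp: path_on_def)
    then show ?thesis
      using that by (cases x) (auto simp: path_on_def)
  qed
  have states: "f x \<in> pverts G \<and> g x \<in> pverts G \<and> k \<le> graph_dist G (f x) (g x)"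
    if "x \<in> pverts (path_on n)" for x
    using vert[OF that] R by (fastforce simp: state_step_def)
  have hom: "weak_hom (path_on n) G f" "weak_hom (path_on n) G g"
    using states R by (fastforce simp: weak_hom_def state_step_def)+
  have dom: "x \<in> pverts (path_on n)" if "(x, y) \<in> parcs (path_on n)" for x y
    using that by (auto simp: path_on_def)
  have "\<exists>x \<in> pverts (path_on n). u = f x" "\<exists>x \<in> pverts (path_on n). u = g x"
    if u: "u \<in> pverts G" for u
  proof -
    obtain v where "(u, v) \<in> parcs G" using vertex_in_arc[OF assms(3) u] .
    from edges[OF this] show "\<exists>x \<in> pverts (path_on n). u = f x" "\<exists>x \<in> pverts (path_on n). u = g x"
      using dom by blast+
  qed
  then have "surjective (path_on n) G f" "surjective (path_on n) G g"
    using states by (auto simp: surjective_def)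
  then have "edge_surjective (path_on n) G f" "edge_surjective (path_on n) G g"
    using edges by (auto simp: edge_surjective_def)
  then have "min_dist (path_on n) G f g \<in> span_via edge_surjective T G"
    unfolding span_via_def using path_graph_path_on[OF \<open>n > 0\<close>] hom R
    by (fastforce simp: state_step_def)
  moreover have "k \<le> min_dist (path_on n) G f g"
    using states path_graph_finite[OF path_graph_path_on[OF \<open>n > 0\<close>]]
    by (auto simp: min_dist_def)
  ultimately show ?thesis by blast
qed

text \<open>The minimum is attained at some vertex of the path, so every value is one of the
  finitely many distances in \<open>G\<close>.\<close>

lemma finite_span_via: "finite (span_via S T G)"
proof (rule finite_subset)
  show "span_via S T G \<subseteq> (\<lambda>(u, v). graph_dist G u v) ` (pverts G \<times> pverts G)"
  proof
    fix d assume "d \<in> span_via S T G"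
    then obtain P :: "nat pair_pre_digraph" and f g where P: "path_graph P" "weak_hom P G f" "weak_hom P G g"
      and d: "d = min_dist P G f g"
      unfolding span_via_def by blast
    have "d \<in> (\<lambda>u. graph_dist G (f u) (g u)) ` pverts P"
      unfolding d min_dist_def by (intro Min_in) (use path_graph_finite[OF P(1)] in auto)
    then show "d \<in> (\<lambda>(u, v). graph_dist G u v) ` (pverts G \<times> pverts G)"
      using P by (auto simp: weak_hom_def)
  qed
qed (use pair_finite_verts in auto)

text \<open>Listing the vertices of the path in order turns the maps into a walk on states. The
  distance bound is stated separately because a one-vertex path has no steps that could carry
  it.\<close>

lemma span_via_states:
  assumes "d \<in> span_via surjective T G"
  obtains xs where "xs \<noteq> []" "successively (state_step T d) xs"
    "fst ` set xs = pverts G" "snd ` set xs = pverts G"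
    "\<And>p. p \<in> set xs \<Longrightarrow> d \<le> graph_dist G (fst p) (snd p)"
proof -
  obtain P :: "nat pair_pre_digraph" and f g where P: "path_graph P" "weak_hom P G f" "weak_hom P G g"
    and surj: "surjective P G f" "surjective P G g"
    and T: "\<forall>(x, y) \<in> parcs P. T (f x, g x) (f y, g y)"
    and d: "d = min_dist P G f g"
    using assms unfolding span_via_def by blast
  obtain vs where vs: "vs \<noteq> []" "pverts P = set vs"
    and "parcs P = {(vs ! i, vs ! Suc i) | i. Suc i < length vs}
                 \<union> {(vs ! Suc i, vs ! i) | i. Suc i < length vs}"
    using P(1) unfolding path_graph_def by blast
  then have arcs: "(vs ! i, vs ! Suc i) \<in> parcs P" if "Suc i < length vs" for i
    using that by auto
  have dist: "d \<le> graph_dist G (f x) (g x)" if "x \<in> set vs" for x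
    using that vs(2) by (simp add: d min_dist_def)
  have "state_step T d (f x, g x) (f y, g y)"
    if "(x, y) \<in> parcs P" "x \<in> set vs" "y \<in> set vs" for x y
    using P T that dist vs(2) by (fastforce simp: state_step_def weak_hom_def)
  then have "successively (state_step T d) (map (\<lambda>x. (f x, g x)) vs)"
    using arcs by (simp add: successively_conv_nth)
  then show thesis
    using vs surj dist by (intro that[of "map (\<lambda>x. (f x, g x)) vs"])
      (auto simp: surjective_def image_image)
qed

section \<open>Comparison of vertex and edge spans\<close>

lemma span_via_edge_surjective_no_arcs:
  assumes "parcs G = {}"
  shows "span_via edge_surjective T G = span_via surjective T G"
  using assms by (simp add: span_via_def edge_surjective_def)

text \<open>Coverage at level 0 makes both sets of values nonempty, so the maxima are attained;
  \<open>step\<close> is then applied to a walk realising the vertex maximum.\<close>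

lemma Max_span_via_le:
  assumes "symp T" and zero: "parcs G \<noteq> {} \<Longrightarrow> covers T 0"
    and step: "\<And>xs k. \<lbrakk>parcs G \<noteq> {}; xs \<noteq> []; successively (state_step T k) xs;
      fst ` set xs = pverts G; snd ` set xs = pverts G;
      \<And>p. p \<in> set xs \<Longrightarrow> k \<le> graph_dist G (fst p) (snd p)\<rbrakk> \<Longrightarrow> covers T (k - 1)"
  shows "Max (span_via surjective T G) \<le> Max (span_via edge_surjective T G) + 1"
proof (cases "parcs G = {}")
  case True
  then show ?thesis by (simp add: span_via_edge_surjective_no_arcs)
next
  case False
  have "span_via edge_surjective T G \<subseteq> span_via surjective T G"
    by (auto simp: span_via_def edge_surjective_def)
  moreover have "span_via edge_surjective T G \<noteq> {}"
    using covers_realise[OF zero assms(1)] False by blast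
  ultimately have "Max (span_via surjective T G) \<in> span_via surjective T G"
    using finite_span_via by (intro Max_in) auto
  then have "covers T (Max (span_via surjective T G) - 1)"
    using span_via_states step[OF False] by metis
  then obtain d where "d \<in> span_via edge_surjective T G" "Max (span_via surjective T G) - 1 \<le> d"
    using covers_realise assms(1) False by blast
  then show ?thesis
    using Max_ge[OF finite_span_via] by fastforce
qed

section \<open>Strong and Cartesian spans\<close>

lemma excursion:
  assumes "(u, v) \<in> parcs G" "w \<in> pverts G"
  shows "T (u, w) (v, w) \<Longrightarrow> k \<le> graph_dist G u w \<Longrightarrow> state_step T (k - 1) (u, w) (v, w)"
    and "T (w, u) (w, v) \<Longrightarrow> k \<le> graph_dist G w u \<Longrightarrow> state_step T (k - 1) (w, u) (w, v)"
  using assms graph_dist_arc_fst[OF assms] graph_dist_arc_snd[of v u w] in_arcsD1 in_arcsD2 arc_sym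
  by (auto simp: state_step_def)

lemma Max_span_via_le_single_moves:
  assumes "symp T"
    and T: "\<And>u v w. (u, v) \<in> parcs G \<Longrightarrow> T (u, w) (v, w) \<and> T (w, u) (w, v)"
  shows "Max (span_via surjective T G) \<le> Max (span_via edge_surjective T G) + 1"
proof (rule Max_span_via_le[OF assms(1)])
  assume "parcs G \<noteq> {}"
  \<comment> \<open>At level 0 the distance is no constraint: from \<open>(a, a)\<close> either
    player walks to any vertex while the other stays at \<open>a\<close>.\<close>
  then obtain a where a: "a \<in> pverts G" using in_arcsD1 by fast
  let ?R = "state_step T 0"
  have move: "?R (u, w) (v, w)" "?R (w, u) (w, v)" if "(u, v) \<in> parcs G" "w \<in> pverts G" for u v w
    using excursion[OF that, where k = 0] T[OF that(1)] by auto
  have reach: "?R\<^sup>*\<^sup>* (a, a) (u, a)" "?R\<^sup>*\<^sup>* (a, a) (a, u)" if "u \<in> pverts G" for u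
  proof -
    have "(a, u) \<in> (parcs G)\<^sup>*" using rtrancl_parcs a that by blast
    then show "?R\<^sup>*\<^sup>* (a, a) (u, a)" "?R\<^sup>*\<^sup>* (a, a) (a, u)"
      by (induction rule: rtrancl_induct) (use move a in \<open>auto intro: rtranclp.rtrancl_into_rtrancl\<close>)
  qed
  have "\<exists>p q. ?R\<^sup>*\<^sup>* (a, a) p \<and> ?R p q \<and> fst p = u \<and> fst q = v"
       "\<exists>p q. ?R\<^sup>*\<^sup>* (a, a) p \<and> ?R p q \<and> snd p = u \<and> snd q = v"
    if uv: "(u, v) \<in> parcs G" for u v
    using move[OF uv a] reach[OF in_arcsD1[OF uv]] by (meson fst_conv snd_conv)+
  then show "covers T 0"
    unfolding covers_def by blast
next
  fix xs k
  assume xs: "xs \<noteq> []" "successively (state_step T k) xs"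
    "fst ` set xs = pverts G" "snd ` set xs = pverts G"
    and dist: "\<And>p. p \<in> set xs \<Longrightarrow> k \<le> graph_dist G (fst p) (snd p)"
  let ?R = "state_step T (k - 1)"
  \<comment> \<open>Lowering the bound keeps all of \<open>xs\<close> in one component, from which
    the excursions to distance \<open>k - 1\<close> branch off.\<close>
  have "successively ?R xs"
    using xs(2) by (rule successively_mono) (auto intro: state_step_mono)
  then have reach: "?R\<^sup>*\<^sup>* (xs ! 0) p" if "p \<in> set xs" for p
    using that in_set_conv_nth[of p xs] successively_rtranclp_nth by auto
  have "\<exists>p q. ?R\<^sup>*\<^sup>* (xs ! 0) p \<and> ?R p q \<and> fst p = u \<and> fst q = v"
       "\<exists>p q. ?R\<^sup>*\<^sup>* (xs ! 0) p \<and> ?R p q \<and> snd p = u \<and> snd q = v"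
    if uv: "(u, v) \<in> parcs G" for u v
  proof -
    obtain w where w: "(u, w) \<in> set xs" using xs(3) in_arcsD1[OF uv] by force
    then have "w \<in> pverts G" using xs(4) by force
    then have "?R (u, w) (v, w)" using excursion(1) T uv dist[OF w] by simp
    then show "\<exists>p q. ?R\<^sup>*\<^sup>* (xs ! 0) p \<and> ?R p q \<and> fst p = u \<and> fst q = v"
      using reach[OF w] by force
    obtain w where w: "(w, u) \<in> set xs" using xs(4) in_arcsD1[OF uv] by force
    then have "w \<in> pverts G" using xs(3) by force
    then have "?R (w, u) (w, v)" using excursion(2) T uv dist[OF w] by simp
    then show "\<exists>p q. ?R\<^sup>*\<^sup>* (xs ! 0) p \<and> ?R p q \<and> snd p = u \<and> snd q = v"
      using reach[OF w] by force
  qed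
  then show "covers T (k - 1)"
    unfolding covers_def by blast
qed

section \<open>Direct spans\<close>

definition both_or_none :: "'a \<times> 'a \<Rightarrow> 'a \<times> 'a \<Rightarrow> bool" where
  "both_or_none p q \<longleftrightarrow> ((fst p, fst q) \<in> parcs G \<longleftrightarrow> (snd p, snd q) \<in> parcs G)"

lemma symp_both_or_none: "symp both_or_none"
  unfolding symp_def both_or_none_def using arc_sym by metis

lemma state_step_both:
  assumes "(a, c) \<in> parcs G" "(b, d) \<in> parcs G" "k \<le> graph_dist G a b" "k \<le> graph_dist G c d"
  shows "state_step both_or_none k (a, b) (c, d)"
  using assms in_arcsD1 in_arcsD2 by (auto simp: state_step_def both_or_none_def)

text \<open>Both players walk together along the diagonal, so one step serves both of them.\<close>

lemma covers_both_or_none_0: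
  assumes "parcs G \<noteq> {}"
  shows "covers both_or_none 0"
proof -
  let ?R = "state_step both_or_none 0"
  obtain a where a: "a \<in> pverts G" using assms in_arcsD1 by fast
  have reach: "?R\<^sup>*\<^sup>* (a, a) (u, u)" if "u \<in> pverts G" for u
  proof -
    have "(a, u) \<in> (parcs G)\<^sup>*" using rtrancl_parcs a that by blast
    then show ?thesis
      by (induction rule: rtrancl_induct)
        (auto intro: rtranclp.rtrancl_into_rtrancl state_step_both)
  qed
  have "\<exists>p q. ?R\<^sup>*\<^sup>* (a, a) p \<and> ?R p q \<and> fst p = u \<and> fst q = v \<and> snd p = u \<and> snd q = v"
    if uv: "(u, v) \<in> parcs G" for u v
    by (intro exI[of _ "(u, u)"] exI[of _ "(v, v)"])
      (use uv reach[OF in_arcsD1[OF uv]] in \<open>auto intro: state_step_both\<close>)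
  then show ?thesis
    unfolding covers_def by blast
qed

text \<open>The delayed states \<open>(f (Suc i), g i)\<close> miss \<open>f 0\<close> and the last
  value of \<open>g\<close>. The states \<open>(f i, g (Suc i))\<close>, delayed the other way,
  supply these; a single step joins the two kinds.\<close>

lemma covers_both_or_none_delay:
  assumes "parcs G \<noteq> {}" "xs \<noteq> []" "successively (state_step both_or_none k) xs"
    and surj: "fst ` set xs = pverts G" "snd ` set xs = pverts G"
  shows "covers both_or_none (k - 1)"
proof -
  let ?R = "state_step both_or_none (k - 1)"
  let ?step = "\<lambda>p q. state_step both_or_none k p q \<and> (fst p, fst q) \<in> parcs G \<and> (snd p, snd q) \<in> parcs G"
  \<comment> \<open>Consecutive entries of \<open>ys\<close> differ, and under this rule a change of
    state means that both players move.\<close>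
  define ys where "ys = remdups_adj xs"
  have set_ys: "set ys = set xs" by (simp add: ys_def)
  have step: "?step (ys ! i) (ys ! Suc i)" if "Suc i < length ys" for i
  proof -
    have "state_step both_or_none k (ys ! i) (ys ! Suc i)"
      using successively_remdups_adjI[OF assms(3)] that unfolding ys_def successively_conv_nth by blast
    moreover have "ys ! i \<noteq> ys ! Suc i"
      using that unfolding ys_def by (intro distinct_adj_nth) auto
    ultimately show ?thesis
      by (auto simp: state_step_def both_or_none_def prod_eq_iff)
  qed
  \<comment> \<open>With one state only, surjectivity would leave \<open>G\<close> a single vertex
    and its arc a loop. Two states are needed for the start \<open>?z\<close> of the delayed
    walk.\<close>
  have len: "Suc 0 < length ys"
  proof (rule ccontr)
    assume "\<not> Suc 0 < length ys"
    moreover have "ys \<noteq> []" using assms(2) by (simp add: ys_def)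
    ultimately obtain y where "set ys = {y}" by (cases ys) auto
    then have "pverts G = {fst y}" using surj(1) set_ys by simp
    moreover obtain u v where "(u, v) \<in> parcs G" using assms(1) by auto
    ultimately show False using in_arcsD1 in_arcsD2 no_loop by (metis singletonD)
  qed
  define f where "f i = fst (ys ! i)" for i
  define g where "g i = snd (ys ! i)" for i
  have arc: "(f i, f (Suc i)) \<in> parcs G" "(f (Suc i), f i) \<in> parcs G"
      "(g i, g (Suc i)) \<in> parcs G" "(g (Suc i), g i) \<in> parcs G"
    and k: "k \<le> graph_dist G (f i) (g i)" "k \<le> graph_dist G (f (Suc i)) (g (Suc i))"
    if "Suc i < length ys" for i
    using step[OF that] arc_sym by (auto simp: f_def g_def state_step_def)
  have near: "k - 1 \<le> graph_dist G v w" if "k \<le> graph_dist G u w" "(u, v) \<in> parcs G" "w \<in> pverts G" for u v w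
    using that graph_dist_arc_fst[OF that(2,3)] by linarith
  have near': "k - 1 \<le> graph_dist G w v" if "k \<le> graph_dist G w u" "(u, v) \<in> parcs G" "w \<in> pverts G" for u v w
    using that graph_dist_arc_snd[of v u w] arc_sym by fastforce
  \<comment> \<open>Each mixed pair arises from \<open>(f i, g i)\<close> or
    \<open>(f (Suc i), g (Suc i))\<close>, at distance at least \<open>k\<close>, by moving the
    first player along one arc.\<close>
  have cross: "k - 1 \<le> graph_dist G (f (Suc i)) (g i)" "k - 1 \<le> graph_dist G (f i) (g (Suc i))"
    if "Suc i < length ys" for i
    using near[OF k(1) arc(1)] near[OF k(2) arc(2)] arc that in_arcsD1 by blast+
  let ?z = "(f (Suc 0), g 0)"
  have reach: "?R\<^sup>*\<^sup>* ?z (f (Suc i), g i)" if "Suc i < length ys" for i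
    using that
  proof (induction i)
    case (Suc i)
    then have "?R (f (Suc i), g i) (f (Suc (Suc i)), g (Suc i))"
      using arc cross by (intro state_step_both) auto
    moreover have "?R\<^sup>*\<^sup>* ?z (f (Suc i), g i)" using Suc by simp
    ultimately show ?case by (rule rtranclp.rtrancl_into_rtrancl[rotated])
  qed simp
  have reach': "?R\<^sup>*\<^sup>* ?z (f i, g (Suc i))" if "Suc i < length ys" for i
  proof -
    have "?R (f (Suc i), g i) (f i, g (Suc i))"
      using that arc cross by (intro state_step_both) auto
    with reach[OF that] show ?thesis by (rule rtranclp.rtrancl_into_rtrancl)
  qed
  \<comment> \<open>Entry 0 is the first member of a consecutive pair, every later entry the second;
    hence the two cases below.\<close>
  have index: "\<exists>i. Suc i < length ys \<and> (p = ys ! i \<or> p = ys ! Suc i)" if "p \<in> set xs" for p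
  proof -
    have "p \<in> set ys" using that set_ys by simp
    then obtain j where "j < length ys" "p = ys ! j"
      unfolding in_set_conv_nth by blast
    then show ?thesis using len by (cases j) auto
  qed
  have "\<exists>p q. ?R\<^sup>*\<^sup>* ?z p \<and> ?R p q \<and> fst p = u \<and> fst q = v"
    if uv: "(u, v) \<in> parcs G" for u v
  proof -
    obtain p where "p \<in> set xs" "fst p = u" using surj(1) in_arcsD1[OF uv] by force
    then obtain i where i: "Suc i < length ys" "u = f i \<or> u = f (Suc i)"
      using index unfolding f_def by metis
    from i(2) show ?thesis
    proof
      assume u: "u = f i"
      \<comment> \<open>The second player steps to \<open>g i\<close>, its original partner position
        for \<open>u\<close>. As that is at distance at least \<open>k\<close> from
        \<open>u\<close>, moving to \<open>v\<close> leaves at least \<open>k - 1\<close>.\<close>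
      have "?R (f i, g (Suc i)) (v, g i)"
        using uv u arc[OF i(1)] cross[OF i(1)] near[OF k(1)[OF i(1)]] in_arcsD1
        by (intro state_step_both) auto
      then show ?thesis using reach'[OF i(1)] u by force
    next
      assume u: "u = f (Suc i)"
      have "?R (f (Suc i), g i) (v, g (Suc i))"
        using uv u arc[OF i(1)] cross[OF i(1)] near[OF k(2)[OF i(1)]] in_arcsD1
        by (intro state_step_both) auto
      then show ?thesis using reach[OF i(1)] u by force
    qed
  qed
  moreover have "\<exists>p q. ?R\<^sup>*\<^sup>* ?z p \<and> ?R p q \<and> snd p = u \<and> snd q = v"
    if uv: "(u, v) \<in> parcs G" for u v
  proof -
    obtain p where "p \<in> set xs" "snd p = u" using surj(2) in_arcsD1[OF uv] by force
    then obtain i where i: "Suc i < length ys" "u = g i \<or> u = g (Suc i)"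
      using index unfolding g_def by metis
    from i(2) show ?thesis
    proof
      assume u: "u = g i"
      \<comment> \<open>The same exchange with the players' roles swapped: the first player returns
        to \<open>f i\<close>, at distance at least \<open>k\<close> from \<open>u\<close>.\<close>
      have "?R (f (Suc i), g i) (f i, v)"
        using uv u arc[OF i(1)] cross[OF i(1)] near'[OF k(1)[OF i(1)]] in_arcsD1
        by (intro state_step_both) auto
      then show ?thesis using reach[OF i(1)] u by force
    next
      assume u: "u = g (Suc i)"
      have "?R (f i, g (Suc i)) (f (Suc i), v)"
        using uv u arc[OF i(1)] cross[OF i(1)] near'[OF k(2)[OF i(1)]] in_arcsD1
        by (intro state_step_both) auto
      then show ?thesis using reach'[OF i(1)] u by force
    qed
  qed
  ultimately show ?thesis
    unfolding covers_def by blast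
qed

section \<open>The three inequalities as instances\<close>

lemma strong_spans:
  "strong_vertex_span G \<le> strong_edge_span G + 1"
  using Max_span_via_le_single_moves[of "\<lambda>_ _. True"]
  by (simp add: symp_def strong_vertex_span_def strong_edge_span_def span_of_def span_via_def)

lemma cartesian_spans:
  "cartesian_vertex_span G \<le> cartesian_edge_span G + 1"
proof -
  let ?T = "\<lambda>p q. (fst p, fst q) \<in> parcs G \<longleftrightarrow> snd p = snd q"
  have "symp ?T" unfolding symp_def using arc_sym by metis
  then have "Max (span_via surjective ?T G) \<le> Max (span_via edge_surjective ?T G) + 1"
    \<comment> \<open>A single move obeys the opposite rule in either coordinate because
      \<open>G\<close> has no loops: \<open>(w, w)\<close> is no arc, and an arc
      \<open>(u, v)\<close> has \<open>u\<close> different from \<open>v\<close>.\<close>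
    by (rule Max_span_via_le_single_moves) auto
  then show ?thesis
    by (simp add: cartesian_vertex_span_def cartesian_edge_span_def span_of_def span_via_def
        opposite_def)
qed

lemma direct_spans:
  "direct_vertex_span G \<le> direct_edge_span G + 1"
proof -
  have "Max (span_via surjective both_or_none G) \<le> Max (span_via edge_surjective both_or_none G) + 1"
    by (rule Max_span_via_le[OF symp_both_or_none covers_both_or_none_0 covers_both_or_none_delay])
  then show ?thesis
    by (simp add: direct_vertex_span_def direct_edge_span_def span_of_def span_via_def
        aligned_def both_or_none_def)
qed

end

theorem theorem2p1:
  fixes G :: "'a pair_pre_digraph"
  assumes "pair_graph G" and "connected (with_proj G)"
  shows "int (strong_vertex_span G) - int (strong_edge_span G) \<le> 1
       \<and> int (cartesian_vertex_span G) - int (cartesian_edge_span G) \<le> 1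
       \<and> int (direct_vertex_span G) - int (direct_edge_span G) \<le> 1"
proof -
  interpret connected_pair_graph G
    using assms by (simp add: connected_pair_graph_def connected_pair_graph_axioms_def)
  show ?thesis
    using strong_spans cartesian_spans direct_spans by linarith
qed

end
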